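(* Consider a nonlinear, control-affine system with parametric uncertainty $$\dot x(t) = f(x(t)) + g(x(t))u(t) + \Delta(x(t))\theta,\qquad x(t_0)=x_0,$$ with unknown constant parameters $\theta\in\Theta\subset\mathbb{R}^p$. If $x$, $\varphi(x,u)=f(x)+g(x)u$ and $\Phi(x)=\Delta(x)$ are filtered by the second-order filters given in the context, and the auxiliary matrix $P$ and vectors $Q$, $W$ are those defined in the context, then, under the adaptation law $$\dot{\hat\theta}=\Gamma W\left(W^TP^{-T}W\right)^{-1}\left(-c_{1e}\nu^{\gamma_{1e}}-c_{2e}\nu^{\gamma_{2e}}\right),$$ the estimated parameters $\hat\theta(t)$ converge to the true parameters $\theta$ in fixed time $T_\theta$, i.e. $\tilde\theta(t)\to 0$ and $\hat\theta(t)\to\theta$ as $t\to T_\theta$, where $$T_\theta\le T_b=\frac{1}{c_{1e}(1-\gamma_{1e})}+\frac{1}{c_{2e}(\gamma_{2e}-1)},$$ with $\nu=\frac12 W^TP^{-T}\Gamma^{-1}P^{-1}W$, $c_{1e}>0$, $c_{2e}>0$, $0<\gamma_{1e}<1$, $\gamma_{2e}>1$, and $\Gamma\in\mathbb{R}^{p\times p}$ a constant, positive-definite gain matrix.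
   Context: System: $x(t)\in\mathbb{R}^n$ is the state, $u(t)\in U\subset\mathbb{R}^m$ the control input; $f:\mathbb{R}^n\to\mathbb{R}^n$ and $g:\mathbb{R}^n\to\mathbb{R}^{n\times m}$ are locally Lipschitz, $\Delta:\mathbb{R}^n\to\mathbb{R}^{n\times p}$ is a known regressor matrix, and $f,g,\Delta$ are bounded for bounded inputs. $\hat\theta(t)$ is the estimate of $\theta$ and $\tilde\theta=\theta-\hat\theta$ is the parameter estimation error, so $\dot{\tilde\theta}=-\dot{\hat\theta}$, $\tilde\theta(0)=\tilde\theta_0$. Standing assumptions: (1) $\Theta$ is known, compact and convex. (2) The state $x$ and control input $u$ are bounded, and $x$ is accessible for measurement. (3) $\Delta^T(x)$ is persistently excited, where a vector or matrix function $\phi$ is persistently excited if there exist $T>0$, $\epsilon>0$ such that $\int_t^{t+T}\phi(r)\phi^T(r)\,dr\ge\epsilon I$ for all $t\ge0$. Filters: with design parameter $k_e>0$, for each $\beta\in\{x,\varphi,\Phi\}$ the filtered quantity $\beta_f$ satisfies $k_e^2\ddot\beta_f+2k_e\dot\beta_f+\beta_f=\beta$ with all initial conditions zero: $\beta_f(0)=0$, $\dot\beta_f(0)=0$, $\ddot\beta_f(0)=0$. The filtered system dynamics are $\dot x_f=\varphi_f+\Phi_f\theta$. Auxiliary variables: with design parameter $\ell_e>0$, $\dot P=-\ell_eP+\Phi_f^T\Phi_f$, $P(0)=0$, and $\dot Q=-\ell_eQ+\Phi_f^T(\dot x_f-\varphi_f)$, $Q(0)=0$; so $P(t)=\int_0^te^{-\ell_e(t-r)}\Phi_f^T(r)\Phi_f(r)\,dr$,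 $Q(t)=\int_0^te^{-\ell_e(t-r)}\Phi_f^T(r)(\dot x_f(r)-\varphi_f(r))\,dr$ and $Q=P\theta$. Finally $W=P\hat\theta-Q=-P\tilde\theta$. Fixed time: the origin of the error dynamics is reached within a settling time $T_\theta$ that is bounded independently of $\tilde\theta(0)$.
   Formalization: T_θ is counted from the time after which P(t) is invertible (this is 0 if P(t) is invertible for all t>0), since the law is undefined while P is singular; Γ is taken symmetric; t_0=0, and the zero initial conditions of the filter for x force x_0=0. *)

theory Defs
  imports "HOL-Analysis.Analysis"
begin

definition bounded_on_bounded :: "('a::metric_space \<Rightarrow> 'b::metric_space) \<Rightarrow> bool" where
  "bounded_on_bounded h \<longleftrightarrow> (\<forall>S. bounded S \<longrightarrow> bounded (h ` S))"

definition psd :: "real^'n^'n \<Rightarrow> bool" where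
  "psd M \<longleftrightarrow> transpose M = M \<and> (\<forall>v. 0 \<le> v \<bullet> (M *v v))"

(* As usual for gain matrices, positive definiteness includes symmetry. *)
definition pos_def :: "real^'n^'n \<Rightarrow> bool" where
  "pos_def M \<longleftrightarrow> transpose M = M \<and> (\<forall>v. v \<noteq> 0 \<longrightarrow> 0 < v \<bullet> (M *v v))"

(* The inequality is in the Loewner order.  Integrability of the integrand is implied, because
   integral returns 0 for a function that is not integrable and - \<epsilon> I is not psd. *)
definition persistently_excited :: "(real \<Rightarrow> real^'q^'p) \<Rightarrow> bool" where
  "persistently_excited \<phi> \<longleftrightarrow>
     (\<exists>T>0. \<exists>\<epsilon>>0. \<forall>t\<ge>0.
        psd (integral {t..t+T} (\<lambda>r. \<phi> r ** transpose (\<phi> r)) - \<epsilon> *\<^sub>R mat 1))"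

(* y' = F on [0, \<infinity>) in the integrated (Caratheodory) sense, so that F may be discontinuous in time,
   e.g. through the control input.  Classical solutions are covered, see the lemma below. *)
definition ode_solution :: "(real \<Rightarrow> 'a::euclidean_space) \<Rightarrow> (real \<Rightarrow> 'a) \<Rightarrow> bool" where
  "ode_solution y F \<longleftrightarrow> (\<forall>t\<ge>0. (F has_integral (y t - y 0)) {0..t})"

lemma ode_solution_classical:
  assumes "\<And>t. 0 \<le> t \<Longrightarrow> (y has_vector_derivative F t) (at t within {0..})"
  shows "ode_solution y F"
  unfolding ode_solution_def
proof (intro allI impI)
  fix t :: real assume "0 \<le> t"
  then show "(F has_integral (y t - y 0)) {0..t}"
    by (rule fundamental_theorem_of_calculus)
       (auto intro: has_vector_derivative_within_subset[OF assms])
qed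

(* k^2 y'' + 2 k y' + y = \<beta> on the time set I, with zero initial conditions; dy and ddy are y' and y''.
   If 0 \<in> I, the condition y''(0) = 0 forces \<beta> 0 = 0.  If I = {0<..}, the input is unrestricted
   and y'' may jump away from its initial value 0.  For the state x the instant 0 must be included:
   filtering the dynamics gives x_f' = \<phi>_f + \<Phi>_f \<theta> only if x 0 = 0, otherwise a decaying transient
   remains.  The possibly discontinuous signals \<phi> and \<Phi> need no such restriction. *)
definition filtered ::
  "real set \<Rightarrow> real \<Rightarrow> (real \<Rightarrow> 'a::euclidean_space) \<Rightarrow>
   (real \<Rightarrow> 'a) \<Rightarrow> (real \<Rightarrow> 'a) \<Rightarrow> (real \<Rightarrow> 'a) \<Rightarrow> bool" where
  "filtered I k \<beta> y dy ddy \<longleftrightarrow>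
     y 0 = 0 \<and> dy 0 = 0 \<and> ddy 0 = 0 \<and>
     ode_solution y dy \<and> ode_solution dy ddy \<and>
     (\<forall>t\<in>I. k\<^sup>2 *\<^sub>R ddy t + (2 * k) *\<^sub>R dy t + y t = \<beta> t)"

definition nu :: "real^'p^'p \<Rightarrow> real^'p^'p \<Rightarrow> real^'p \<Rightarrow> real" where
  "nu \<Gamma> P W =
     1 / 2 * (W \<bullet> ((transpose (matrix_inv P) ** matrix_inv \<Gamma> ** matrix_inv P) *v W))"

definition adaptation_law ::
  "real^'p^'p \<Rightarrow> real \<Rightarrow> real \<Rightarrow> real \<Rightarrow> real \<Rightarrow> real^'p^'p \<Rightarrow> real^'p \<Rightarrow> real^'p" where
  "adaptation_law \<Gamma> c1 c2 \<gamma>1 \<gamma>2 P W =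
     (inverse (W \<bullet> (transpose (matrix_inv P) *v W)) *
       (- c1 * nu \<Gamma> P W powr \<gamma>1 - c2 * nu \<Gamma> P W powr \<gamma>2)) *\<^sub>R (\<Gamma> *v W)"

(* The adaptation law contains the inverse of P(t), but P(0) = 0 and P(t) stays singular as long as
   the data are not exciting.  The law is meaningful only from this onset time on; it is the
   initial time 0 whenever P(t) is invertible for all t > 0. *)
definition onset :: "(real \<Rightarrow> real^'p^'p) \<Rightarrow> real" where
  "onset P = Inf {t. 0 \<le> t \<and> invertible (P t)}"

lemma onset_eq_0:
  assumes "\<And>t. 0 < t \<Longrightarrow> invertible (P t)"
  shows "onset P = 0"
  unfolding onset_def
proof (rule cInf_eq)
  fix y :: real
  assume lb: "\<And>t. t \<in> {t. 0 \<le> t \<and> invertible (P t)} \<Longrightarrow> y \<le> t"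
  show "y \<le> 0"
    using lb[of "y / 2"] assms[of "y / 2"] by (cases "0 < y") auto
qed auto

end

theory Submission
  imports Defs
begin

text \<open>
Write \<open>e = \<theta>h - \<theta>\<close> for the estimation error. Filtering commutes with differentiation when
the filters start at rest and the differentiated signal starts at zero, so the filtered signals satisfy the static linear regression
\<open>dxf = \<phi>f + \<Phi>f \<theta>\<close> (\<open>filter_of_derivative\<close>). Feeding this into the equation of \<open>Q\<close> shows that
\<open>Q\<close> and \<open>P \<theta>\<close> solve the same linear equation from the same initial value; hence \<open>Q = P \<theta>\<close> and
\<open>W = P e\<close>: the computable signal \<open>W\<close> carries the unknown error.

The weighted form \<open>exp (l t) * (v \<bullet> P t v)\<close> accumulates the integral of \<open>exp (l r) * |\<Phi>f r v|^2\<close>.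
It therefore never decreases, and if it vanishes at \<open>t\<close> then \<open>\<Phi>f v\<close> vanishes on all of \<open>[0, t]\<close>
(\<open>form_zero_imp_no_information\<close>). Two things follow. Invertibility of \<open>P\<close>, once gained, is kept and
means that the form is positive. And it is gained in finite time: a kernel vector \<open>v\<close> of \<open>P T\<close> would
make the filter output \<open>\<Phi>f v\<close> zero on \<open>[0, T]\<close>, thus the filter input \<open>\<Delta> v\<close> zero almost everywhere
there, which contradicts persistent excitation when \<open>T\<close> is the length of the excitation window
(\<open>excitation_imp_invertible\<close>).

After the onset take \<open>V = e \<bullet> \<Gamma>^-1 e / 2\<close>, which is \<open>\<nu>\<close> rewritten through \<open>W = P e\<close>. The factor
\<open>\<Gamma> W\<close> in the law contributes \<open>e \<bullet> P e\<close> to the derivative of \<open>V\<close>, and this is exactly the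
denominator \<open>W \<bullet> P^-T W\<close>, so that \<open>V' = - c1 V^\<gamma>1 - c2 V^\<gamma>2\<close> as long as \<open>V\<close> is positive
(\<open>lyapunov_derivative\<close>). This scalar equation reaches zero in a time bounded independently of the
initial value: the term with \<open>\<gamma>2 > 1\<close> brings \<open>V\<close> down from anywhere to \<open>1\<close> within
\<open>1 / (c2 (\<gamma>2 - 1))\<close>, and the term with \<open>\<gamma>1 < 1\<close> brings it from \<open>1\<close> to \<open>0\<close> within
\<open>1 / (c1 (1 - \<gamma>1))\<close> (\<open>fixed_time_extinction\<close>).
\<close>

section \<open>Integrated differential equations\<close>

lemma ode_solution_cong:
  assumes "ode_solution y F" and "\<And>t. 0 \<le> t \<Longrightarrow> F t = G t"
  shows "ode_solution y G"
  unfolding ode_solution_def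
proof (intro allI impI)
  fix t :: real assume "0 \<le> t"
  with assms(1) have "(F has_integral (y t - y 0)) {0..t}"
    by (simp add: ode_solution_def)
  then show "(G has_integral (y t - y 0)) {0..t}"
    by (rule has_integral_eq[rotated]) (use assms(2) in auto)
qed

lemma ode_solution_bounded_linear:
  assumes "ode_solution y F" and "bounded_linear h"
  shows "ode_solution (\<lambda>t. h (y t)) (\<lambda>t. h (F t))"
  unfolding ode_solution_def
proof (intro allI impI)
  fix t :: real assume "0 \<le> t"
  with assms(1) have "(F has_integral (y t - y 0)) {0..t}"
    by (simp add: ode_solution_def)
  from has_integral_linear[OF this assms(2)]
  show "((\<lambda>t. h (F t)) has_integral (h (y t) - h (y 0))) {0..t}"
    using assms(2) by (simp add: o_def linear_simps)
qed

lemma ode_solution_add: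
  assumes "ode_solution y F" and "ode_solution z G"
  shows "ode_solution (\<lambda>t. y t + z t) (\<lambda>t. F t + G t)"
  unfolding ode_solution_def
proof (intro allI impI)
  fix t :: real assume "0 \<le> t"
  with assms have "(F has_integral (y t - y 0)) {0..t}" "(G has_integral (z t - z 0)) {0..t}"
    by (simp_all add: ode_solution_def)
  from has_integral_add[OF this]
  show "((\<lambda>t. F t + G t) has_integral (y t + z t - (y 0 + z 0))) {0..t}"
    by (simp add: algebra_simps)
qed

lemma ode_solution_diff:
  assumes "ode_solution y F" and "ode_solution z G"
  shows "ode_solution (\<lambda>t. y t - z t) (\<lambda>t. F t - G t)"
  using ode_solution_add[OF assms(1) ode_solution_bounded_linear[OF assms(2),
        of "\<lambda>v. - v"]] bounded_linear_minus[OF bounded_linear_ident]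
  by simp

lemma ode_solution_integral:
  assumes "ode_solution y F" and "0 \<le> t"
  shows "integral {0..t} F = y t - y 0"
  using assms by (auto simp: ode_solution_def)

lemma ode_solution_integrable:
  assumes "ode_solution y F" and "0 \<le> t"
  shows "F integrable_on {0..t}"
  using assms by (auto simp: ode_solution_def)

text \<open>An integrated equation places no regularity on its right-hand side, yet its solution is an
indefinite integral and hence continuous. When the right-hand side is a continuous expression in
such solutions, differentiability follows; these two facts upgrade the filter states and \<open>P\<close> to
classical solutions.\<close>
lemma ode_solution_continuous:
  assumes "ode_solution y F"
  shows "continuous_on {0..} y"
  unfolding continuous_on_eq_continuous_within
proof
  fix t :: real assume t: "t \<in> {0..}"
  have "continuous_on {0..t + 1} (\<lambda>s. y 0 + integral {0..s} F)"
    using t by (intro continuous_intros indefinite_integral_continuous_1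
        ode_solution_integrable[OF assms]) auto
  moreover have "y 0 + integral {0..s} F = y s" if "s \<in> {0..t + 1}" for s
    using ode_solution_integral[OF assms, of s] that by simp
  ultimately have "continuous_on {0..t + 1} y"
    by (metis (no_types, lifting) continuous_on_cong)
  then have "continuous (at t within {0..t + 1}) y"
    using t by (auto simp: continuous_on_eq_continuous_within)
  moreover have "at t within {0..t + 1} = at t within {0..}"
    by (rule at_within_nhd[of _ "{..<t + 1}"]) auto
  ultimately show "continuous (at t within {0..}) y"
    by (simp add: continuous_within)
qed

lemma ode_solution_has_vector_derivative:
  assumes "ode_solution y F" and cont: "continuous_on {0..} F" and t: "0 \<le> t"
  shows "(y has_vector_derivative F t) (at t within {0..})"
proof -
  have "((\<lambda>s. integral {0..s} F) has_vector_derivative F t) (at t within {0..t + 1})"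
    using t by (intro integral_has_vector_derivative continuous_on_subset[OF cont]) auto
  then have "((\<lambda>s. y 0 + integral {0..s} F) has_vector_derivative F t) (at t within {0..t + 1})"
    by (auto intro!: derivative_eq_intros)
  then have "(y has_vector_derivative F t) (at t within {0..t + 1})"
    by (rule has_vector_derivative_transform[rotated 2])
       (use t ode_solution_integral[OF assms(1)] in auto)
  moreover have "at t within {0..t + 1} = at t within {0..}"
    by (rule at_within_nhd[of _ "{..<t + 1}"]) auto
  ultimately show ?thesis
    by simp
qed

lemma nondecreasing_on_half_line:
  fixes q :: "real \<Rightarrow> real"
  assumes der: "\<And>t. 0 \<le> t \<Longrightarrow> (q has_real_derivative q' t) (at t within {0..})"
    and nonneg: "\<And>t. 0 \<le> t \<Longrightarrow> 0 \<le> q' t"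
    and "0 \<le> s" and "s \<le> t"
  shows "q s \<le> q t"
proof (rule DERIV_nonneg_imp_increasing_open[OF \<open>s \<le> t\<close>])
  fix r assume r: "s < r" "r < t"
  then have "at r within {0..} = at r"
    using \<open>0 \<le> s\<close> by (intro at_within_interior) auto
  then show "\<exists>y. DERIV q r :> y \<and> 0 \<le> y"
    using der[of r] nonneg[of r] r \<open>0 \<le> s\<close> by auto
next
  have "continuous_on {0..} q"
    using der by (intro DERIV_continuous_on) auto
  then show "continuous_on {s..t} q"
    by (rule continuous_on_subset) (use \<open>0 \<le> s\<close> in auto)
qed

lemma has_real_derivative_inner:
  assumes "(y has_vector_derivative y') (at t within S)"
    and "(z has_vector_derivative z') (at t within S)"
  shows "((\<lambda>t. y t \<bullet> z t) has_real_derivative (y t \<bullet> z' + y' \<bullet> z t)) (at t within S)"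
  using bounded_bilinear.has_vector_derivative[OF bounded_bilinear_inner assms]
  by (simp add: has_real_derivative_iff_has_vector_derivative)

text \<open>Multiplying by the integrating factor makes \<open>exp (2 l t) * |y t|^2\<close> constant.\<close>
lemma linear_decay_from_zero:
  fixes y :: "real \<Rightarrow> 'a::euclidean_space"
  assumes ode: "ode_solution y (\<lambda>t. - l *\<^sub>R y t)" and "y 0 = 0" and t: "0 \<le> t"
  shows "y t = 0"
proof -
  define q where "q t = - (exp (2 * l * t) * (y t \<bullet> y t))" for t
  have cont: "continuous_on {0..} (\<lambda>t. - l *\<^sub>R y t)"
    by (intro continuous_intros ode_solution_continuous[OF ode])
  have "(q has_real_derivative 0) (at s within {0..})" if "0 \<le> s" for s
    unfolding q_def
    by (rule derivative_eq_intros refl has_real_derivative_inner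
        ode_solution_has_vector_derivative[OF ode cont that])+
       (simp add: algebra_simps)
  from nondecreasing_on_half_line[OF this, where s = 0 and t = t] t
  have "exp (2 * l * t) * (y t \<bullet> y t) \<le> 0"
    by (simp add: q_def \<open>y 0 = 0\<close>)
  then show ?thesis
    by (metis exp_gt_zero inner_eq_zero_iff inner_ge_zero mult_le_0_iff not_le order_antisym)
qed

section \<open>Filtering the dynamics\<close>

text \<open>The energy \<open>|d|^2 + k^2 |e|^2\<close> of the homogeneous filter equation dissipates at the rate
\<open>4 k |e|^2\<close>; starting from zero it stays zero. This is the uniqueness theorem for the filter.\<close>
lemma damped_oscillator_at_rest:
  fixes d e h :: "real \<Rightarrow> 'a::euclidean_space"
  assumes d: "ode_solution d e" and e: "ode_solution e h"
    and "d 0 = 0" and "e 0 = 0" and "0 < k" and t: "0 \<le> t"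
    and eq: "\<And>t. 0 \<le> t \<Longrightarrow> k\<^sup>2 *\<^sub>R h t + (2 * k) *\<^sub>R e t + d t = 0"
  shows "e t = 0"
proof -
  define E where "E t = - (d t \<bullet> d t + k\<^sup>2 * (e t \<bullet> e t))" for t
  \<comment> \<open>The acceleration agrees with a continuous function, so that \<open>e\<close> is differentiable.\<close>
  define h' where "h' t = - (1 / k\<^sup>2) *\<^sub>R ((2 * k) *\<^sub>R e t + d t)" for t
  have h: "k\<^sup>2 *\<^sub>R h t = - ((2 * k) *\<^sub>R e t + d t)" if "0 \<le> t" for t
    unfolding eq_neg_iff_add_eq_0 using eq[OF that] by (simp add: add.assoc)
  have "h t = h' t" if "0 \<le> t" for t
  proof -
    have "h t = (1 / k\<^sup>2) *\<^sub>R (k\<^sup>2 *\<^sub>R h t)"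
      using \<open>0 < k\<close> by simp
    also have "\<dots> = h' t"
      unfolding h[OF that] h'_def by (simp only: scaleR_minus_left scaleR_minus_right)
    finally show ?thesis .
  qed
  then have e': "ode_solution e h'"
    using ode_solution_cong[OF e] by blast
  have cont: "continuous_on {0..} e" "continuous_on {0..} h'"
    unfolding h'_def
    by (intro continuous_intros ode_solution_continuous[OF d] ode_solution_continuous[OF e])+
  have "(E has_real_derivative 4 * k * (e s \<bullet> e s)) (at s within {0..})" if s: "0 \<le> s" for s
  proof -
    have "k\<^sup>2 *\<^sub>R h' s = - ((2 * k) *\<^sub>R e s + d s)"
      using \<open>0 < k\<close> by (simp add: h'_def)
    then have "e s \<bullet> (k\<^sup>2 *\<^sub>R h' s) = e s \<bullet> (- ((2 * k) *\<^sub>R e s + d s))"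
      by simp
    then have eh: "k\<^sup>2 * (e s \<bullet> h' s) = - 2 * k * (e s \<bullet> e s) - e s \<bullet> d s"
      by (simp add: inner_diff_right)
    show ?thesis
      unfolding E_def
      by (rule derivative_eq_intros refl has_real_derivative_inner
          ode_solution_has_vector_derivative[OF d cont(1) s]
          ode_solution_has_vector_derivative[OF e' cont(2) s])+
         (use eh in \<open>simp add: algebra_simps inner_commute\<close>)
  qed
  from nondecreasing_on_half_line[OF this, where s = 0 and t = t] t \<open>0 < k\<close>
  have "d t \<bullet> d t + k\<^sup>2 * (e t \<bullet> e t) \<le> 0"
    by (simp add: E_def \<open>d 0 = 0\<close> \<open>e 0 = 0\<close>)
  moreover have "0 \<le> d t \<bullet> d t" "0 \<le> k\<^sup>2 * (e t \<bullet> e t)"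
    by simp_all
  ultimately have "k\<^sup>2 * (e t \<bullet> e t) = 0"
    by linarith
  then show ?thesis
    using \<open>0 < k\<close> by simp
qed

lemma filtered_bounded_linear:
  assumes "filtered I k \<beta> y dy ddy" and "bounded_linear h"
  shows "filtered I k (\<lambda>t. h (\<beta> t)) (\<lambda>t. h (y t)) (\<lambda>t. h (dy t)) (\<lambda>t. h (ddy t))"
proof -
  interpret bounded_linear h by fact
  have "k\<^sup>2 *\<^sub>R h (ddy t) + (2 * k) *\<^sub>R h (dy t) + h (y t) = h (\<beta> t)" if "t \<in> I" for t
    using assms(1) that unfolding filtered_def by (metis add scaleR)
  then show ?thesis
    using assms(1) unfolding filtered_def
    by (auto simp: zero intro!: ode_solution_bounded_linear[OF _ assms(2)])
qed

lemma filtered_add: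
  assumes "filtered I k \<beta> y dy ddy" and "filtered I k \<beta>' y' dy' ddy'"
  shows "filtered I k (\<lambda>t. \<beta> t + \<beta>' t) (\<lambda>t. y t + y' t) (\<lambda>t. dy t + dy' t) (\<lambda>t. ddy t + ddy' t)"
proof -
  have "k\<^sup>2 *\<^sub>R (ddy t + ddy' t) + (2 * k) *\<^sub>R (dy t + dy' t) + (y t + y' t) = \<beta> t + \<beta>' t"
    if "t \<in> I" for t
  proof -
    have "k\<^sup>2 *\<^sub>R ddy t + (2 * k) *\<^sub>R dy t + y t = \<beta> t"
      "k\<^sup>2 *\<^sub>R ddy' t + (2 * k) *\<^sub>R dy' t + y' t = \<beta>' t"
      using assms that by (auto simp: filtered_def)
    from this[symmetric] show ?thesis
      by (simp add: algebra_simps)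
  qed
  then show ?thesis
    using assms unfolding filtered_def by (auto intro!: ode_solution_add)
qed

text \<open>The filtered derivative of \<open>x\<close> is the derivative of the filtered \<open>x\<close>. To see this, integrate the
filter equation of the input \<open>F = x'\<close> once: the antiderivative \<open>\<zeta>\<close> of its output satisfies the filter
equation with input \<open>x\<close> and zero initial data, so it coincides with \<open>xf\<close>. No transient
appears because the equation at time zero, with \<open>ddxf 0 = 0\<close>, forces \<open>x 0 = 0\<close>.\<close>
lemma filter_of_derivative:
  fixes x F :: "real \<Rightarrow> 'a::euclidean_space"
  assumes fx: "filtered {0..} k x xf dxf ddxf"
    and fF: "filtered {0<..} k F z dz ddz"
    and x: "ode_solution x F" and "0 < k" and t: "0 \<le> t"
  shows "dxf t = z t"
proof -
  define \<zeta> where "\<zeta> t = integral {0..t} z" for t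
  have z: "z 0 = 0" "dz 0 = 0" "ode_solution z dz" "ode_solution dz ddz"
    and z_eq: "\<And>t. 0 < t \<Longrightarrow> k\<^sup>2 *\<^sub>R ddz t + (2 * k) *\<^sub>R dz t + z t = F t"
    using fF by (auto simp: filtered_def)
  have xf: "xf 0 = 0" "dxf 0 = 0" "ddxf 0 = 0" "ode_solution xf dxf" "ode_solution dxf ddxf"
    and x_eq: "\<And>t. 0 \<le> t \<Longrightarrow> k\<^sup>2 *\<^sub>R ddxf t + (2 * k) *\<^sub>R dxf t + xf t = x t"
    using fx by (auto simp: filtered_def)
  have x0: "x 0 = 0"
    using x_eq[of 0] xf by simp
  have "continuous_on {0..} z"
    by (rule ode_solution_continuous[OF z(3)])
  then have \<zeta>: "ode_solution \<zeta> z"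
    unfolding ode_solution_def \<zeta>_def
    by (auto intro!: integrable_integral integrable_continuous_real elim: continuous_on_subset)
  have \<zeta>_eq: "k\<^sup>2 *\<^sub>R dz t + (2 * k) *\<^sub>R z t + \<zeta> t = x t" if "0 \<le> t" for t
  proof -
    have "((\<lambda>s. k\<^sup>2 *\<^sub>R ddz s + (2 * k) *\<^sub>R dz s + z s) has_integral
        (k\<^sup>2 *\<^sub>R (dz t - dz 0) + (2 * k) *\<^sub>R (z t - z 0) + (\<zeta> t - \<zeta> 0))) {0..t}"
      using z(3,4) \<zeta> that unfolding ode_solution_def
      by (intro has_integral_add has_integral_cmul) auto
    \<comment> \<open>The filter equation of \<open>F\<close> may fail at the single instant zero.\<close>
    then have "(F has_integral (k\<^sup>2 *\<^sub>R dz t + (2 * k) *\<^sub>R z t + \<zeta> t)) {0..t}"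
      by (intro has_integral_spike_finite[of "{0}" "{0..t}" F])
         (use z_eq z in \<open>auto simp: \<zeta>_def\<close>)
    moreover have "(F has_integral x t) {0..t}"
      using x that x0 by (auto simp: ode_solution_def)
    ultimately show ?thesis
      by (rule has_integral_unique)
  qed
  have "dxf t - z t = 0"
  proof (rule damped_oscillator_at_rest[OF ode_solution_diff[OF xf(4) \<zeta>]
        ode_solution_diff[OF xf(5) z(3)] _ _ \<open>0 < k\<close> t])
    fix t :: real assume "0 \<le> t"
    then show "k\<^sup>2 *\<^sub>R (ddxf t - dz t) + (2 * k) *\<^sub>R (dxf t - z t) + (xf t - \<zeta> t) = 0"
      using x_eq[of t] \<zeta>_eq[of t] by (simp add: algebra_simps)
  qed (use xf z in \<open>auto simp: \<zeta>_def\<close>)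
  then show ?thesis by simp
qed

text \<open>Lebesgue's differentiation theorem: almost everywhere, the value of an integrable function is the
limit of its averages over shrinking intervals, and here all these averages vanish.\<close>
lemma zero_integrals_imp_zero_almost_everywhere:
  fixes F :: "real \<Rightarrow> 'a::euclidean_space"
  assumes "\<And>t. t \<in> {0..T} \<Longrightarrow> (F has_integral 0) {0..t}"
  shows "\<exists>N. negligible N \<and> (\<forall>t\<in>{0..T} - N. F t = 0)"
proof -
  \<comment> \<open>The differentiation theorem asks for integrability over every interval, hence the
      extension by zero.\<close>
  define G where "G t = (if t \<in> {0..T} then F t else 0)" for t
  have sub: "(F has_integral 0) {a..b}" if "0 \<le> a" "a \<le> b" "b \<le> T" for a b
  proof -
    have Fb: "(F has_integral 0) {0..b}" and Fa: "(F has_integral 0) {0..a}"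
      using assms[of b] assms[of a] that by auto
    then have "F integrable_on {a..b}"
      using that by (auto intro: integrable_subinterval_real[of F 0 b])
    moreover from this have "integral {a..b} F = 0"
      using Henstock_Kurzweil_Integration.integral_combine[of 0 a b F] that Fa Fb
      by (auto simp: integral_unique has_integral_integrable)
    ultimately show ?thesis
      by (metis integrable_integral)
  qed
  have G: "(G has_integral 0) (cbox a b)" for a b
  proof -
    have "(F has_integral 0) ({0..T} \<inter> cbox a b)"
      using sub[of "max 0 a" "min T b"]
      by (cases "max 0 a \<le> min T b") (auto simp: Int_atLeastAtMost has_integral_is_0)
    then show ?thesis
      unfolding G_def has_integral_restrict_Int .
  qed
  then have "G integrable_on cbox a b" for a b
    by blast
  from integrable_ccontinuous_explicit[OF this] obtain N where N: "negligible N"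
    "\<And>x e. \<lbrakk>x \<notin> N; 0 < e\<rbrakk> \<Longrightarrow> \<exists>d>0. \<forall>h. 0 < h \<and> h < d \<longrightarrow>
        norm (integral (cbox x (x + h *\<^sub>R One)) G /\<^sub>R h ^ DIM(real) - G x) < e"
    by metis
  have "G x = 0" if "x \<notin> N" for x
  proof (rule ccontr)
    assume "G x \<noteq> 0"
    then obtain d where "d > 0" and d: "\<And>h. 0 < h \<and> h < d \<Longrightarrow>
        norm (integral (cbox x (x + h *\<^sub>R One)) G /\<^sub>R h ^ DIM(real) - G x) < norm (G x)"
      using N(2)[OF \<open>x \<notin> N\<close>, of "norm (G x)"] by auto
    from d[of "d / 2"] \<open>d > 0\<close> show False
      by (simp add: integral_unique[OF G[unfolded box_real]])
  qed
  then have "F x = 0" if "x \<in> {0..T} - N" for x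
    using that by (metis DiffD1 DiffD2 G_def)
  then show ?thesis
    using N(1) by blast
qed

text \<open>If the output vanishes on an interval then so does its continuous derivative \<open>dy\<close>, so the integrals
of \<open>ddy\<close> vanish, and on that interval the input is \<open>k^2 ddy\<close>. Since \<open>ddy\<close> is only an integrable
function, the conclusion holds up to a null set.\<close>
lemma filter_output_zero_imp_input_zero:
  fixes \<beta> :: "real \<Rightarrow> 'a::euclidean_space"
  assumes filt: "filtered {0<..} k \<beta> y dy ddy"
    and T: "0 < T" and zero: "\<And>t. t \<in> {0..T} \<Longrightarrow> y t = 0"
  shows "\<exists>N. negligible N \<and> (\<forall>t\<in>{0..T} - N. \<beta> t = 0)"
proof -
  have y: "dy 0 = 0" "ode_solution y dy" "ode_solution dy ddy"
    and eq: "\<And>t. 0 < t \<Longrightarrow> k\<^sup>2 *\<^sub>R ddy t + (2 * k) *\<^sub>R dy t + y t = \<beta> t"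
    using filt by (auto simp: filtered_def)
  have dy: "dy t = 0" if t: "t \<in> {0..T}" for t
  proof (rule vector_derivative_unique_within_closed_interval)
    have "(y has_vector_derivative dy t) (at t within {0..})"
      using t by (intro ode_solution_has_vector_derivative[OF y(2)] ode_solution_continuous[OF y(3)])
        auto
    then show "(y has_vector_derivative dy t) (at t within cbox 0 T)"
      by (rule has_vector_derivative_within_subset) auto
    show "(y has_vector_derivative 0) (at t within cbox 0 T)"
      by (rule has_vector_derivative_transform[where f = "\<lambda>_. 0"]) (use t zero in auto)
  qed (use t T in auto)
  show ?thesis
  proof (rule zero_integrals_imp_zero_almost_everywhere)
    fix t assume t: "t \<in> {0..T}"
    have "(ddy has_integral 0) {0..t}"
      using y(3) dy[OF t] y(1) t by (auto simp: ode_solution_def)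
    then have "((\<lambda>s. k\<^sup>2 *\<^sub>R ddy s) has_integral k\<^sup>2 *\<^sub>R 0) {0..t}"
      by (rule has_integral_cmul)
    then show "(\<beta> has_integral 0) {0..t}"
      by (intro has_integral_spike_finite[of "{0}" _ \<beta> "\<lambda>s. k\<^sup>2 *\<^sub>R ddy s"])
         (use t eq dy zero in \<open>auto simp flip: eq\<close>)
  qed
qed

section \<open>The information matrix\<close>

lemma inner_transpose_mult:
  fixes A :: "real^'m^'n"
  shows "v \<bullet> (transpose A *v w) = (A *v v) \<bullet> w"
  by (metis dot_lmul_matrix inner_commute transpose_matrix_vector)

lemma bounded_linear_matrix_vector_mult_left:
  "bounded_linear (\<lambda>M :: real^'m^'n. M *v v)"
  by (simp add: linear_conv_bounded_linear[symmetric] linear_iff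
      matrix_vector_mult_add_rdistrib scaleR_matrix_vector_assoc)

lemma continuous_on_transpose_mult:
  fixes A :: "real \<Rightarrow> real^'m^'n"
  assumes "continuous_on S A" and "continuous_on S w"
  shows "continuous_on S (\<lambda>t. transpose (A t) *v w t)"
  unfolding matrix_vector_mult_def transpose_def
  using assms by (auto intro!: continuous_intros)

lemma invertible_iff_trivial_kernel:
  fixes A :: "real^'n^'n"
  shows "invertible A \<longleftrightarrow> (\<forall>v. A *v v = 0 \<longrightarrow> v = 0)"
  by (simp add: invertible_left_inverse matrix_left_invertible_ker)

lemma matrix_inv_mult_vector:
  fixes A :: "real^'n^'n"
  assumes "invertible A"
  shows "matrix_inv A *v (A *v v) = v" and "A *v (matrix_inv A *v v) = v"
proof -
  have "A ** matrix_inv A = mat 1 \<and> matrix_inv A ** A = mat 1"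
    unfolding matrix_inv_def by (rule someI_ex) (use assms in \<open>simp add: invertible_def\<close>)
  then show "matrix_inv A *v (A *v v) = v" and "A *v (matrix_inv A *v v) = v"
    by (simp_all add: matrix_vector_mul_assoc)
qed

text \<open>The matrix \<open>P\<close> is the exponentially weighted Gram matrix of the past of \<open>\<Phi>\<close>: the form
\<open>v \<bullet> P t v\<close> measures how much has been learnt by time \<open>t\<close> in the direction \<open>v\<close>.\<close>
locale information_matrix =
  fixes l :: real and P :: "real \<Rightarrow> real^'p^'p" and \<Phi> :: "real \<Rightarrow> real^'p^'n"
  assumes P_ode: "ode_solution P (\<lambda>t. - l *\<^sub>R P t + transpose (\<Phi> t) ** \<Phi> t)"
    and P_0: "P 0 = 0"
    and \<Phi>_cont: "continuous_on {0..} \<Phi>"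
begin

lemma P_apply_ode:
  "ode_solution (\<lambda>t. P t *v v) (\<lambda>t. - l *\<^sub>R (P t *v v) + transpose (\<Phi> t) *v (\<Phi> t *v v))"
  using ode_solution_bounded_linear[OF P_ode bounded_linear_matrix_vector_mult_left[of v]]
  unfolding matrix_vector_mult_add_rdistrib scaleR_matrix_vector_assoc[symmetric]
    matrix_vector_mul_assoc[symmetric] .

text \<open>The integrating factor removes the forgetting term. The bilinear version, with two different
vectors, is what later turns a vanishing form into a kernel vector: a vector is zero if its inner
product with every \<open>w\<close> is.\<close>
lemma weighted_form_derivative:
  assumes t: "0 \<le> t"
  shows "((\<lambda>t. exp (l * t) * (w \<bullet> (P t *v v))) has_real_derivative
           exp (l * t) * ((\<Phi> t *v w) \<bullet> (\<Phi> t *v v))) (at t within {0..})"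
proof -
  have "continuous_on {0..} (\<lambda>t. \<Phi> t *v v)"
    by (rule bounded_linear.continuous_on[OF bounded_linear_matrix_vector_mult_left \<Phi>_cont])
  then have "continuous_on {0..} (\<lambda>t. - l *\<^sub>R (P t *v v) + transpose (\<Phi> t) *v (\<Phi> t *v v))"
    by (intro continuous_intros ode_solution_continuous[OF P_apply_ode]
        continuous_on_transpose_mult \<Phi>_cont)
  from ode_solution_has_vector_derivative[OF P_apply_ode this t]
  have "((\<lambda>t. w \<bullet> (P t *v v)) has_real_derivative
      (w \<bullet> (- l *\<^sub>R (P t *v v) + transpose (\<Phi> t) *v (\<Phi> t *v v)) + 0 \<bullet> (P t *v v)))
      (at t within {0..})"
    by (intro has_real_derivative_inner) (auto intro!: derivative_eq_intros)
  moreover have "((\<lambda>t. exp (l * t)) has_real_derivative exp (l * t) * l) (at t within {0..})"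
    by (auto intro!: derivative_eq_intros)
  ultimately have "((\<lambda>t. exp (l * t) * (w \<bullet> (P t *v v))) has_real_derivative
      exp (l * t) * l * (w \<bullet> (P t *v v)) +
      (w \<bullet> (- l *\<^sub>R (P t *v v) + transpose (\<Phi> t) *v (\<Phi> t *v v)) + 0 \<bullet> (P t *v v)) * exp (l * t))
      (at t within {0..})"
    by (intro DERIV_mult)
  moreover have "exp (l * t) * l * (w \<bullet> (P t *v v)) +
      (w \<bullet> (- l *\<^sub>R (P t *v v) + transpose (\<Phi> t) *v (\<Phi> t *v v)) + 0 \<bullet> (P t *v v)) * exp (l * t)
      = exp (l * t) * ((\<Phi> t *v w) \<bullet> (\<Phi> t *v v))"
    unfolding inner_add_right inner_transpose_mult by (simp add: algebra_simps)
  ultimately show ?thesis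
    by simp
qed

lemma form_nonneg:
  assumes "0 \<le> t"
  shows "0 \<le> v \<bullet> (P t *v v)"
proof -
  have "exp (l * 0) * (v \<bullet> (P 0 *v v)) \<le> exp (l * t) * (v \<bullet> (P t *v v))"
    by (rule nondecreasing_on_half_line[OF weighted_form_derivative]) (use assms in auto)
  then show ?thesis
    by (simp add: P_0 zero_le_mult_iff)
qed

text \<open>The weighted form increases from zero; if it is zero at \<open>t\<close>, it is constant on \<open>[0, t]\<close> and its
derivative, a multiple of \<open>|\<Phi> s v|^2\<close>, vanishes there. With \<open>\<Phi> v = 0\<close> all the bilinear forms
\<open>w \<bullet> P s v\<close> have zero derivative too, hence \<open>P s v = 0\<close>.\<close>
lemma form_zero_imp_no_information:
  assumes t: "0 < t" and zero: "v \<bullet> (P t *v v) = 0" and s: "s \<in> {0..t}"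
  shows "\<Phi> s *v v = 0" and "P s *v v = 0"
proof -
  define q where "q t = exp (l * t) * (v \<bullet> (P t *v v))" for t
  have q0: "q r = 0" if "r \<in> {0..t}" for r
  proof -
    have "q r \<le> q t"
      unfolding q_def
      by (rule nondecreasing_on_half_line[OF weighted_form_derivative]) (use that in auto)
    moreover have "0 \<le> q r"
      using form_nonneg[of r v] that by (simp add: q_def)
    ultimately show ?thesis
      using zero by (simp add: q_def)
  qed
  have \<Phi>0: "\<Phi> r *v v = 0" if r: "r \<in> {0..t}" for r
  proof -
    have "(q has_vector_derivative exp (l * r) * ((\<Phi> r *v v) \<bullet> (\<Phi> r *v v))) (at r within {0..})"
      using weighted_form_derivative[of r v v] r
      unfolding q_def by (simp add: has_real_derivative_iff_has_vector_derivative)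
    then have 1: "(q has_vector_derivative exp (l * r) * ((\<Phi> r *v v) \<bullet> (\<Phi> r *v v)))
        (at r within cbox 0 t)"
      by (rule has_vector_derivative_within_subset) auto
    have 2: "(q has_vector_derivative 0) (at r within cbox 0 t)"
      by (rule has_vector_derivative_transform[where f = "\<lambda>_. 0"]) (use r q0 in auto)
    have "exp (l * r) * ((\<Phi> r *v v) \<bullet> (\<Phi> r *v v)) = 0"
      by (rule vector_derivative_unique_within_closed_interval[OF t _ 1 2]) (use r in auto)
    then show ?thesis
      by simp
  qed
  show "\<Phi> s *v v = 0"
    by (rule \<Phi>0[OF s])
  have "w \<bullet> (P s *v v) = 0" for w
  proof -
    define b where "b t = exp (l * t) * (w \<bullet> (P t *v v))" for t
    have "(b has_real_derivative 0) (at r within {0..t})" if "r \<in> {0..t}" for r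
    proof -
      have "(b has_real_derivative exp (l * r) * ((\<Phi> r *v w) \<bullet> (\<Phi> r *v v))) (at r within {0..t})"
        unfolding b_def
        by (rule DERIV_subset[OF weighted_form_derivative]) (use that in auto)
      then show ?thesis
        by (simp add: \<Phi>0[OF that])
    qed
    then obtain c where "\<And>r. r \<in> {0..t} \<Longrightarrow> b r = c"
      using has_field_derivative_zero_constant[of "{0..t}" b] by auto
    from this[of 0] this[of s] t s show ?thesis
      by (simp add: b_def P_0)
  qed
  then show "P s *v v = 0"
    by (metis inner_eq_zero_iff)
qed

lemma invertible_imp_form_pos:
  assumes "0 < t" and "invertible (P t)" and "v \<noteq> 0"
  shows "0 < v \<bullet> (P t *v v)"
proof -
  have "v \<bullet> (P t *v v) \<noteq> 0"
    using form_zero_imp_no_information(2)[OF \<open>0 < t\<close>, of v t] assms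
    by (auto simp: invertible_iff_trivial_kernel)
  with form_nonneg[of t v] \<open>0 < t\<close> show ?thesis
    by linarith
qed

text \<open>A kernel vector of \<open>P t\<close> belongs to the kernel of every earlier \<open>P s\<close>.\<close>
lemma invertible_upward:
  assumes "0 \<le> s" and "s \<le> t" and "invertible (P s)"
  shows "invertible (P t)"
proof (cases "s = t")
  case False
  with assms have t: "0 < t" and s: "s \<in> {0..t}"
    by auto
  have "v = 0" if "P t *v v = 0" for v
  proof -
    have "v \<bullet> (P t *v v) = 0"
      using that by simp
    from form_zero_imp_no_information(2)[OF t this s] show ?thesis
      using \<open>invertible (P s)\<close> by (simp add: invertible_iff_trivial_kernel)
  qed
  then show ?thesis
    by (simp add: invertible_iff_trivial_kernel)
qed (use assms in simp)

end

text \<open>The onset is the left end of an upward closed set of times. The set has to be nonempty, as the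
infimum of the empty set would be meaningless.\<close>
lemma invertible_after_onset:
  assumes "0 \<le> T" and "invertible (P T)"
    and up: "\<And>s t. \<lbrakk>0 \<le> s; s \<le> t; invertible (P s)\<rbrakk> \<Longrightarrow> invertible (P t)"
  shows "0 \<le> onset P" and "\<And>t. onset P < t \<Longrightarrow> invertible (P t)"
proof -
  have ne: "{t. 0 \<le> t \<and> invertible (P t)} \<noteq> {}"
    using assms by blast
  then show "0 \<le> onset P"
    unfolding onset_def by (intro cInf_greatest) auto
  fix t assume "onset P < t"
  then obtain s where "0 \<le> s" "invertible (P s)" "s < t"
    using cInf_lessD[OF ne] unfolding onset_def by blast
  then show "invertible (P t)"
    using up by (meson less_imp_le)
qed

text \<open>Take the excitation window that starts at time zero. If \<open>D v\<close> vanished almost everywhere on it, the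
excitation integral would annihilate \<open>v\<close>, against the lower bound \<open>\<epsilon> |v|^2\<close>.\<close>
lemma persistently_excited_imp_kernel_trivial:
  fixes D :: "real \<Rightarrow> real^'p^'n"
  assumes "persistently_excited (\<lambda>t. transpose (D t))"
  shows "\<exists>T>0. \<forall>v N. negligible N \<and> (\<forall>t\<in>{0..T} - N. D t *v v = 0) \<longrightarrow> v = 0"
proof -
  obtain T \<epsilon> where T: "T > 0" and \<epsilon>: "\<epsilon> > 0"
    and "psd (integral {0..0 + T} (\<lambda>r. transpose (D r) ** transpose (transpose (D r)))
           - \<epsilon> *\<^sub>R mat 1)"
    using assms unfolding persistently_excited_def by blast
  then have psd: "psd (integral {0..T} (\<lambda>r. transpose (D r) ** D r) - \<epsilon> *\<^sub>R mat 1)"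
    by simp
  define M where "M = integral {0..T} (\<lambda>r. transpose (D r) ** D r)"
  have "v = 0" if N: "negligible N" and zero: "\<And>t. t \<in> {0..T} - N \<Longrightarrow> D t *v v = 0" for v N
  proof (rule ccontr)
    assume "v \<noteq> 0"
    have "0 \<le> v \<bullet> ((M - \<epsilon> *\<^sub>R mat 1) *v v)"
      using psd by (simp add: psd_def M_def)
    also have "\<dots> = v \<bullet> (M *v v) - \<epsilon> * (v \<bullet> v)"
      by (simp add: matrix_vector_mult_diff_rdistrib inner_diff_right
          scaleR_matrix_vector_assoc[symmetric])
    \<comment> \<open>For a non-integrable integrand the integral is zero by convention, and the claim is trivial.\<close>
    also have "M *v v = 0"
    proof (cases "(\<lambda>r. transpose (D r) ** D r) integrable_on {0..T}")
      case True
      then have "((\<lambda>r. transpose (D r) ** D r) has_integral M) {0..T}"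
        unfolding M_def by (rule integrable_integral)
      from has_integral_linear[OF this bounded_linear_matrix_vector_mult_left[of v]]
      have "((\<lambda>r. transpose (D r) *v (D r *v v)) has_integral M *v v) {0..T}"
        by (simp add: o_def matrix_vector_mul_assoc)
      moreover have "((\<lambda>r. transpose (D r) *v (D r *v v)) has_integral 0) {0..T}"
        by (rule has_integral_negligible[OF N]) (use zero in auto)
      ultimately show ?thesis
        by (rule has_integral_unique)
    next
      case False
      then show ?thesis
        by (simp add: M_def not_integrable_integral)
    qed
    finally have "\<epsilon> * (v \<bullet> v) \<le> 0"
      by simp
    moreover have "0 < \<epsilon> * (v \<bullet> v)"
      using \<epsilon> \<open>v \<noteq> 0\<close> by simp
    ultimately show False
      by linarith
  qed
  then show ?thesis
    using T by blast
qed

text \<open>Excitation survives the filter, because the filter does not turn a nonzero signal into zero.\<close>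
lemma (in information_matrix) excitation_imp_invertible:
  assumes filt: "filtered {0<..} k D \<Phi> d\<Phi> dd\<Phi>"
    and pe: "persistently_excited (\<lambda>t. transpose (D t))"
  shows "\<exists>T>0. invertible (P T)"
proof -
  obtain T where T: "T > 0"
    and ker: "\<And>v N. \<lbrakk>negligible N; \<forall>t\<in>{0..T} - N. D t *v v = 0\<rbrakk> \<Longrightarrow> v = 0"
    using persistently_excited_imp_kernel_trivial[OF pe] by blast
  have "v = 0" if "P T *v v = 0" for v
  proof -
    have "\<Phi> t *v v = 0" if "t \<in> {0..T}" for t
      using form_zero_imp_no_information(1)[OF T, of v] \<open>P T *v v = 0\<close> that by simp
    then show ?thesis
      using filter_output_zero_imp_input_zero[OF filtered_bounded_linear[OF filt
            bounded_linear_matrix_vector_mult_left[of v]] T] ker by blast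
  qed
  then show ?thesis
    using T by (auto simp: invertible_iff_trivial_kernel)
qed

section \<open>Fixed-time extinction of the Lyapunov function\<close>

text \<open>Separation of variables: \<open>V^(1 - \<gamma>) / (1 - \<gamma>) + c t\<close> does not increase. The exponents below and
above \<open>1\<close> are both covered; they differ in which end of the interval bounds the right-hand side.\<close>
lemma power_decay_duration:
  fixes V V' :: "real \<Rightarrow> real"
  assumes "a \<le> b" and "\<gamma> \<noteq> 1"
    and cont: "continuous_on {a..b} V"
    and pos: "\<And>t. t \<in> {a..b} \<Longrightarrow> 0 < V t"
    and der: "\<And>t. t \<in> {a<..<b} \<Longrightarrow> (V has_real_derivative V' t) (at t)"
    and decay: "\<And>t. t \<in> {a<..<b} \<Longrightarrow> V' t \<le> - c * V t powr \<gamma>"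
  shows "c * (b - a) \<le> (V a powr (1 - \<gamma>) - V b powr (1 - \<gamma>)) / (1 - \<gamma>)"
proof -
  define q where "q t = V t powr (1 - \<gamma>) / (1 - \<gamma>) + c * t" for t
  have "q b \<le> q a"
  proof (rule DERIV_nonpos_imp_decreasing_open[OF \<open>a \<le> b\<close>])
    fix t assume t: "a < t" "t < b"
    then have V: "0 < V t" "(V has_real_derivative V' t) (at t)" "V' t \<le> - c * V t powr \<gamma>"
      using pos der decay by auto
    have "((\<lambda>t. V t powr (1 - \<gamma>)) has_real_derivative (1 - \<gamma>) * (V t powr (- \<gamma>) * V' t)) (at t)"
      using DERIV_chain2[OF has_real_derivative_powr[OF V(1), of "1 - \<gamma>"] V(2)]
      by (simp add: mult.assoc)
    from DERIV_cdivide[OF this, of "1 - \<gamma>"]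
    have "((\<lambda>t. V t powr (1 - \<gamma>) / (1 - \<gamma>)) has_real_derivative V t powr (- \<gamma>) * V' t) (at t)"
      using \<open>\<gamma> \<noteq> 1\<close> by simp
    then have dq: "(q has_real_derivative (V t powr (- \<gamma>) * V' t + c)) (at t)"
      unfolding q_def by (rule DERIV_add) (auto intro!: derivative_eq_intros)
    have "V t powr (- \<gamma>) * V' t \<le> V t powr (- \<gamma>) * (- c * V t powr \<gamma>)"
      using V by (intro mult_left_mono) auto
    moreover have "V t powr (- \<gamma>) * (- c * V t powr \<gamma>) = - c"
      using V by (simp add: powr_minus field_simps)
    ultimately have "V t powr (- \<gamma>) * V' t + c \<le> 0"
      by linarith
    with dq show "\<exists>y. DERIV q t :> y \<and> y \<le> 0"
      by blast
  next
    show "continuous_on {a..b} q"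
      unfolding q_def using pos \<open>\<gamma> \<noteq> 1\<close>
      by (intro continuous_intros cont) fastforce+
  qed
  then show ?thesis
    by (simp add: q_def algebra_simps diff_divide_distrib)
qed

text \<open>At level \<open>1\<close> the roles of the two powers change. Where \<open>V\<close> is at least \<open>1\<close>, the quantity
\<open>V^(1 - \<gamma>2)\<close> lies in \<open>[0, 1]\<close> and bounds the duration; where \<open>V\<close> is at most \<open>1\<close>, the quantity
\<open>V^(1 - \<gamma>1)\<close> does. The intermediate value theorem provides the crossing time.\<close>
lemma mixed_power_decay_duration:
  fixes V :: "real \<Rightarrow> real"
  assumes c: "0 < c1" "0 < c2" and \<gamma>: "\<gamma>1 < 1" "1 < \<gamma>2"
    and "a \<le> b" and cont: "continuous_on {a..b} V"
    and pos: "\<And>t. t \<in> {a..b} \<Longrightarrow> 0 < V t"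
    and der: "\<And>t. t \<in> {a<..<b} \<Longrightarrow>
      (V has_real_derivative - c1 * V t powr \<gamma>1 - c2 * V t powr \<gamma>2) (at t)"
  shows "b - a \<le> 1 / (c1 * (1 - \<gamma>1)) + 1 / (c2 * (\<gamma>2 - 1))"
proof -
  have low: "r - s \<le> 1 / (c1 * (1 - \<gamma>1))"
    if "a \<le> s" "s \<le> r" "r \<le> b" "V s \<le> 1" for s r
  proof -
    have "c1 * (r - s) \<le> (V s powr (1 - \<gamma>1) - V r powr (1 - \<gamma>1)) / (1 - \<gamma>1)"
      by (rule power_decay_duration[OF _ _ _ _ der])
         (use that c \<gamma> pos in \<open>auto intro: continuous_on_subset[OF cont]\<close>)
    also have "\<dots> \<le> 1 / (1 - \<gamma>1)"
    proof -
      have "V s powr (1 - \<gamma>1) \<le> 1"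
        using that \<gamma> pos[of s] by (intro powr_le1) auto
      then show ?thesis
        using \<gamma> by (intro divide_right_mono) (auto intro: order_trans[of _ "V s powr (1 - \<gamma>1)"])
    qed
    finally show ?thesis
      using c \<gamma> by (simp add: field_simps)
  qed
  have high: "r - s \<le> 1 / (c2 * (\<gamma>2 - 1))"
    if "a \<le> s" "s \<le> r" "r \<le> b" "1 \<le> V r" for s r
  proof -
    have "c2 * (r - s) \<le> (V s powr (1 - \<gamma>2) - V r powr (1 - \<gamma>2)) / (1 - \<gamma>2)"
      by (rule power_decay_duration[OF _ _ _ _ der])
         (use that c \<gamma> pos in \<open>auto intro: continuous_on_subset[OF cont]\<close>)
    also have "\<dots> = (V r powr (1 - \<gamma>2) - V s powr (1 - \<gamma>2)) / (\<gamma>2 - 1)"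
      using \<gamma> by (simp add: field_simps)
    also have "\<dots> \<le> 1 / (\<gamma>2 - 1)"
    proof -
      have "V r powr (1 - \<gamma>2) \<le> V r powr 0"
        using that \<gamma> by (intro powr_mono) auto
      then have "V r powr (1 - \<gamma>2) \<le> 1"
        using that by simp
      then show ?thesis
        using \<gamma> by (intro divide_right_mono) (auto intro: order_trans[of _ "V r powr (1 - \<gamma>2)"])
    qed
    finally show ?thesis
      using c \<gamma> by (simp add: field_simps)
  qed
  have nonneg: "0 \<le> 1 / (c1 * (1 - \<gamma>1))" "0 \<le> 1 / (c2 * (\<gamma>2 - 1))"
    using c \<gamma> by simp_all
  consider "V a \<le> 1" | "1 \<le> V b" | "V b \<le> 1" "1 \<le> V a"
    by linarith
  then show ?thesis
  proof cases
    case 1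
    then show ?thesis using low[of a b] \<open>a \<le> b\<close> nonneg by linarith
  next
    case 2
    then show ?thesis using high[of a b] \<open>a \<le> b\<close> nonneg by linarith
  next
    case 3
    then obtain m where "a \<le> m" "m \<le> b" "V m = 1"
      using IVT2'[of V b 1 a] cont \<open>a \<le> b\<close> by blast
    then show ?thesis using high[of a m] low[of m b] by linarith
  qed
qed

text \<open>The equation is assumed only where \<open>V\<close> is positive. Zero is still absorbing, as \<open>V\<close> could leave it
only by increasing, while it decreases wherever it is positive. So the zeros form a closed interval
unbounded to the right, and its left end is the settling time.\<close>
lemma fixed_time_extinction:
  fixes V :: "real \<Rightarrow> real"
  assumes c: "0 < c1" "0 < c2" and \<gamma>: "\<gamma>1 < 1" "1 < \<gamma>2"
    and cont: "continuous_on {t0..} V"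
    and nonneg: "\<And>t. t0 \<le> t \<Longrightarrow> 0 \<le> V t"
    and der: "\<And>t. \<lbrakk>t0 < t; 0 < V t\<rbrakk> \<Longrightarrow>
      (V has_real_derivative - c1 * V t powr \<gamma>1 - c2 * V t powr \<gamma>2) (at t)"
  shows "\<exists>T\<ge>0. T \<le> 1 / (c1 * (1 - \<gamma>1)) + 1 / (c2 * (\<gamma>2 - 1)) \<and>
    (\<forall>t. t0 \<le> t \<and> t < t0 + T \<longrightarrow> 0 < V t) \<and> (\<forall>t\<ge>t0 + T. V t = 0)"
proof -
  define K where "K = 1 / (c1 * (1 - \<gamma>1)) + 1 / (c2 * (\<gamma>2 - 1))"
  have K: "0 \<le> K"
    using c \<gamma> by (simp add: K_def)
  have closed_zeros: "closed {t \<in> {a..b}. V t = 0}" if "t0 \<le> a" for a b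
    by (intro continuous_closed_preimage_constant continuous_on_subset[OF cont]) (use that in auto)
  have backward: "0 < V s" if s: "t0 \<le> s" "s \<le> t" and t: "0 < V t" for s t
  proof (rule ccontr)
    assume "\<not> 0 < V s"
    then have "V s = 0"
      using nonneg[of s] s by simp
    define Z where "Z = {r \<in> {s..t}. V r = 0}"
    have Z: "s \<in> Z" "closed Z" "bdd_above Z"
      unfolding Z_def using closed_zeros[of s t] s \<open>V s = 0\<close> by (auto intro: bdd_aboveI[of _ t])
    define z where "z = Sup Z"
    have "z \<in> Z"
      unfolding z_def using Z by (intro closed_contains_Sup) auto
    then have z: "s \<le> z" "z \<le> t" "V z = 0"
      by (auto simp: Z_def)
    have after: "0 < V r" if "z < r" "r \<le> t" for r
    proof -
      have "r \<notin> Z"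
        using cSup_upper[of r Z] Z that by (auto simp: z_def)
      then show ?thesis
        using that z nonneg[of r] s by (auto simp: Z_def less_le)
    qed
    \<comment> \<open>After its last zero \<open>z\<close> before \<open>t\<close>, the function is positive and hence decreasing.\<close>
    have "V t \<le> V z"
    proof (rule DERIV_nonpos_imp_decreasing_open[OF \<open>z \<le> t\<close>])
      fix r assume "z < r" "r < t"
      then have "t0 < r" "0 < V r"
        using after[of r] z s by auto
      then have "DERIV V r :> - c1 * V r powr \<gamma>1 - c2 * V r powr \<gamma>2"
        by (rule der)
      moreover have "0 \<le> c1 * V r powr \<gamma>1" "0 \<le> c2 * V r powr \<gamma>2"
        using c by simp_all
      then have "- c1 * V r powr \<gamma>1 - c2 * V r powr \<gamma>2 \<le> 0"
        by linarith
      ultimately show "\<exists>y. DERIV V r :> y \<and> y \<le> 0"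
        by blast
    next
      show "continuous_on {z..t} V"
        by (rule continuous_on_subset[OF cont]) (use z s in auto)
    qed
    then show False
      using t z by simp
  qed
  have late: "V t = 0" if t: "t0 + K < t" for t
  proof (rule ccontr)
    assume "V t \<noteq> 0"
    then have "0 < V t"
      using nonneg[of t] t K by simp
    then have "t - t0 \<le> K"
      unfolding K_def
      by (intro mixed_power_decay_duration[OF c \<gamma> _ _ _ der])
         (use t K backward[of _ t] in \<open>auto intro: continuous_on_subset[OF cont]\<close>)
    then show False
      using t by simp
  qed
  define Z where "Z = {t. t0 \<le> t \<and> V t = 0}"
  have "Z = {t \<in> {t0..}. V t = 0}"
    by (auto simp: Z_def)
  then have "closed Z"
    using continuous_closed_preimage_constant[OF cont, of 0] by simp
  moreover have Z: "Z \<noteq> {}" "bdd_below Z"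
    using late[of "t0 + K + 1"] K by (auto simp: Z_def intro!: bdd_belowI[of _ t0] exI[of _ "t0 + K + 1"])
  ultimately have "Inf Z \<in> Z"
    by (intro closed_contains_Inf)
  then have Inf_Z: "t0 \<le> Inf Z" "V (Inf Z) = 0"
    by (auto simp: Z_def)
  show ?thesis
  proof (intro exI[of _ "Inf Z - t0"] conjI allI impI)
    show "0 \<le> Inf Z - t0"
      using Inf_Z by simp
    have "Inf Z \<le> t0 + K + e" if "0 < e" for e
      using late[of "t0 + K + e"] that K Z by (intro cInf_lower) (auto simp: Z_def)
    then have "Inf Z \<le> t0 + K"
      by (rule field_le_epsilon)
    then show "Inf Z - t0 \<le> 1 / (c1 * (1 - \<gamma>1)) + 1 / (c2 * (\<gamma>2 - 1))"
      by (simp add: K_def)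
    show "0 < V t" if "t0 \<le> t \<and> t < t0 + (Inf Z - t0)" for t
    proof -
      have "t \<notin> Z"
        using cInf_lower[of t Z] Z that by auto
      then show ?thesis
        using that nonneg[of t] by (auto simp: Z_def less_le)
    qed
    show "V t = 0" if "t0 + (Inf Z - t0) \<le> t" for t
      using backward[of "Inf Z" t] nonneg[of t] Inf_Z that by (cases "0 < V t") auto
  qed
qed

section \<open>The closed loop\<close>

lemma pos_def_invertible:
  assumes "pos_def \<Gamma>"
  shows "invertible \<Gamma>"
  using assms unfolding pos_def_def invertible_iff_trivial_kernel
  by (metis inner_zero_right less_irrefl)

lemma pos_def_inverse_form:
  assumes "pos_def \<Gamma>" and "v \<noteq> 0"
  shows "0 < v \<bullet> (matrix_inv \<Gamma> *v v)"
proof -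
  define w where "w = matrix_inv \<Gamma> *v v"
  have v: "v = \<Gamma> *v w"
    by (simp add: w_def matrix_inv_mult_vector pos_def_invertible assms)
  then have "w \<noteq> 0"
    using \<open>v \<noteq> 0\<close> by auto
  then have "0 < w \<bullet> (\<Gamma> *v w)"
    using assms by (auto simp: pos_def_def)
  then show ?thesis
    by (simp add: w_def[symmetric] v[symmetric] inner_commute)
qed

lemma nu_eq_error_form:
  assumes "invertible P"
  shows "nu \<Gamma> P (P *v e) = 1 / 2 * (e \<bullet> (matrix_inv \<Gamma> *v e))"
  unfolding nu_def matrix_vector_mul_assoc[symmetric] inner_transpose_mult
    matrix_inv_mult_vector(1)[OF assms] ..

text \<open>The law is the scalar \<open>\<kappa>\<close> times \<open>\<Gamma> P e\<close>. The gain cancels against \<open>\<Gamma>^-1\<close> in \<open>V\<close>, by symmetry of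
\<open>\<Gamma>\<close> in one of the two terms of the product rule, which leaves \<open>\<kappa> (e \<bullet> P e)\<close>; the normalisation in
\<open>\<kappa>\<close> is the inverse of \<open>e \<bullet> P e\<close>.\<close>
lemma lyapunov_derivative:
  fixes P :: "real^'p^'p" and \<theta>h :: "real \<Rightarrow> real^'p" and \<theta> :: "real^'p" and \<Gamma> :: "real^'p^'p"
  defines "V \<equiv> \<lambda>t. 1 / 2 * ((\<theta>h t - \<theta>) \<bullet> (matrix_inv \<Gamma> *v (\<theta>h t - \<theta>)))"
  assumes P: "invertible P" and \<Gamma>: "pos_def \<Gamma>"
    and form: "0 < (\<theta>h t - \<theta>) \<bullet> (P *v (\<theta>h t - \<theta>))"
    and law: "(\<theta>h has_vector_derivative
      adaptation_law \<Gamma> c1 c2 \<gamma>1 \<gamma>2 P (P *v (\<theta>h t - \<theta>))) (at t)"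
  shows "(V has_real_derivative - c1 * V t powr \<gamma>1 - c2 * V t powr \<gamma>2) (at t)"
proof -
  define e where "e = \<theta>h t - \<theta>"
  define \<kappa> where "\<kappa> = inverse (e \<bullet> (P *v e)) * (- c1 * V t powr \<gamma>1 - c2 * V t powr \<gamma>2)"
  note inv = matrix_inv_mult_vector[OF pos_def_invertible[OF \<Gamma>]]
  have "nu \<Gamma> P (P *v e) = V t"
    by (simp add: nu_eq_error_form[OF P] V_def e_def)
  then have law': "adaptation_law \<Gamma> c1 c2 \<gamma>1 \<gamma>2 P (P *v e) = \<kappa> *\<^sub>R (\<Gamma> *v (P *v e))"
    by (simp add: adaptation_law_def \<kappa>_def inner_transpose_mult matrix_inv_mult_vector[OF P]
        del: transpose_matrix_vector)
  have de: "((\<lambda>t. \<theta>h t - \<theta>) has_vector_derivative \<kappa> *\<^sub>R (\<Gamma> *v (P *v e))) (at t)"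
    using law unfolding e_def[symmetric] law' by (auto intro!: derivative_eq_intros)
  have dinv: "((\<lambda>t. matrix_inv \<Gamma> *v (\<theta>h t - \<theta>)) has_vector_derivative
      matrix_inv \<Gamma> *v (\<kappa> *\<^sub>R (\<Gamma> *v (P *v e)))) (at t)"
    by (rule bounded_linear.has_vector_derivative[OF matrix_vector_mul_bounded_linear de])
  have "matrix_inv \<Gamma> *v (\<kappa> *\<^sub>R (\<Gamma> *v (P *v e))) = \<kappa> *\<^sub>R (P *v e)"
    by (simp add: matrix_vector_mult_scaleR inv)
  moreover have "(\<kappa> *\<^sub>R (\<Gamma> *v (P *v e))) \<bullet> (matrix_inv \<Gamma> *v e) = \<kappa> * (e \<bullet> (P *v e))"
  proof -
    have "transpose \<Gamma> = \<Gamma>"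
      using \<Gamma> by (simp add: pos_def_def)
    then have "(\<Gamma> *v (P *v e)) \<bullet> (matrix_inv \<Gamma> *v e) = (P *v e) \<bullet> e"
      by (metis inner_transpose_mult inv(2))
    then show ?thesis
      by (simp add: inner_commute)
  qed
  moreover have "\<kappa> * (e \<bullet> (P *v e)) = - c1 * V t powr \<gamma>1 - c2 * V t powr \<gamma>2"
    using form by (simp add: \<kappa>_def e_def[symmetric])
  ultimately show ?thesis
    unfolding V_def
    by - ((rule derivative_eq_intros refl has_real_derivative_inner[OF de dinv])+,
       simp add: e_def[symmetric] V_def)
qed

theorem theorem2:
  fixes f :: "real^'n \<Rightarrow> real^'n"
    and g :: "real^'n \<Rightarrow> real^'m^'n"
    and \<Delta> :: "real^'n \<Rightarrow> real^'p^'n"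
    and U :: "(real^'m) set"
    and \<Theta> :: "(real^'p) set"
    and \<theta> :: "real^'p"
    and x0 :: "real^'n"
    and x :: "real \<Rightarrow> real^'n"
    and u :: "real \<Rightarrow> real^'m"
    and k_e l_e c1 c2 \<gamma>1 \<gamma>2 :: real
    and xf dxf ddxf \<phi>f d\<phi>f dd\<phi>f :: "real \<Rightarrow> real^'n"
    and \<Phi>f d\<Phi>f dd\<Phi>f :: "real \<Rightarrow> real^'p^'n"
    and P :: "real \<Rightarrow> real^'p^'p"
    and Q W \<theta>h :: "real \<Rightarrow> real^'p"
    and \<Gamma> :: "real^'p^'p"
  assumes "local_lipschitz (UNIV :: real set) UNIV (\<lambda>_. f)"
    and "local_lipschitz (UNIV :: real set) UNIV (\<lambda>_. g)"
    and "bounded_on_bounded f" and "bounded_on_bounded g" and "bounded_on_bounded \<Delta>"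
    and "compact \<Theta>" and "convex \<Theta>" and "\<theta> \<in> \<Theta>"
    and "bounded (x ` {0..})" and "bounded (u ` {0..})" and "\<forall>t\<ge>0. u t \<in> U"
    and "x 0 = x0"
    and "ode_solution x (\<lambda>t. f (x t) + g (x t) *v u t + \<Delta> (x t) *v \<theta>)"
    and "persistently_excited (\<lambda>t. transpose (\<Delta> (x t)))"
    and "k_e > 0" and "l_e > 0"
    and "filtered {0..} k_e x xf dxf ddxf"
    and "filtered {0<..} k_e (\<lambda>t. f (x t) + g (x t) *v u t) \<phi>f d\<phi>f dd\<phi>f"
    and "filtered {0<..} k_e (\<lambda>t. \<Delta> (x t)) \<Phi>f d\<Phi>f dd\<Phi>f"
    and "P 0 = 0"
    and "ode_solution P (\<lambda>t. - l_e *\<^sub>R P t + transpose (\<Phi>f t) ** \<Phi>f t)"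
    and "Q 0 = 0"
    and "ode_solution Q (\<lambda>t. - l_e *\<^sub>R Q t + transpose (\<Phi>f t) *v (dxf t - \<phi>f t))"
    and "\<forall>t\<ge>0. W t = P t *v \<theta>h t - Q t"
    and "pos_def \<Gamma>"
    and "c1 > 0" and "c2 > 0" and "0 < \<gamma>1" and "\<gamma>1 < 1" and "\<gamma>2 > 1"
    and "continuous_on {0..} \<theta>h"
    \<comment> \<open>the law holds whenever its right-hand side is defined\<close>
    and "\<forall>t>0. invertible (P t) \<and> W t \<noteq> 0 \<longrightarrow>
           (\<theta>h has_vector_derivative adaptation_law \<Gamma> c1 c2 \<gamma>1 \<gamma>2 (P t) (W t)) (at t)"
  shows "0 \<le> onset P \<and> (\<forall>t>onset P. invertible (P t)) \<and>
    (\<exists>T\<^sub>\<theta>. 0 \<le> T\<^sub>\<theta> \<and> T\<^sub>\<theta> \<le> 1 / (c1 * (1 - \<gamma>1)) + 1 / (c2 * (\<gamma>2 - 1)) \<and>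
       ((\<lambda>t. \<theta> - \<theta>h t) \<longlongrightarrow> 0) (at (onset P + T\<^sub>\<theta>) within {0..}) \<and>
       (\<theta>h \<longlongrightarrow> \<theta>) (at (onset P + T\<^sub>\<theta>) within {0..}) \<and>
       (\<forall>t. onset P \<le> t \<and> t < onset P + T\<^sub>\<theta> \<longrightarrow> \<theta>h t \<noteq> \<theta>) \<and>
       (\<forall>t\<ge>onset P + T\<^sub>\<theta>. \<theta>h t = \<theta>))"
proof -
  from assms have x: "ode_solution x (\<lambda>t. f (x t) + g (x t) *v u t + \<Delta> (x t) *v \<theta>)"
    and pe: "persistently_excited (\<lambda>t. transpose (\<Delta> (x t)))"
    and k: "0 < k_e"
    and filt_x: "filtered {0..} k_e x xf dxf ddxf"
    and filt_\<phi>: "filtered {0<..} k_e (\<lambda>t. f (x t) + g (x t) *v u t) \<phi>f d\<phi>f dd\<phi>f"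
    and filt_\<Phi>: "filtered {0<..} k_e (\<lambda>t. \<Delta> (x t)) \<Phi>f d\<Phi>f dd\<Phi>f"
    and P: "P 0 = 0" "ode_solution P (\<lambda>t. - l_e *\<^sub>R P t + transpose (\<Phi>f t) ** \<Phi>f t)"
    and Q: "Q 0 = 0"
      "ode_solution Q (\<lambda>t. - l_e *\<^sub>R Q t + transpose (\<Phi>f t) *v (dxf t - \<phi>f t))"
    and W: "\<And>t. 0 \<le> t \<Longrightarrow> W t = P t *v \<theta>h t - Q t"
    and \<Gamma>: "pos_def \<Gamma>"
    and c: "0 < c1" "0 < c2" and \<gamma>: "\<gamma>1 < 1" "1 < \<gamma>2"
    and \<theta>h_cont: "continuous_on {0..} \<theta>h"
    and law: "\<And>t. \<lbrakk>0 < t; invertible (P t); W t \<noteq> 0\<rbrakk> \<Longrightarrow>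
      (\<theta>h has_vector_derivative adaptation_law \<Gamma> c1 c2 \<gamma>1 \<gamma>2 (P t) (W t)) (at t)"
    by blast+
  have "continuous_on {0..} \<Phi>f"
    using filt_\<Phi> by (auto simp: filtered_def intro: ode_solution_continuous)
  then interpret information_matrix l_e P \<Phi>f
    using P by unfold_locales

  obtain T where "0 < T" "invertible (P T)"
    using excitation_imp_invertible[OF filt_\<Phi> pe] by blast
  then have T: "0 \<le> T" "invertible (P T)"
    by simp_all
  have onset_nonneg: "0 \<le> onset P"
    by (rule invertible_after_onset(1)[of T P, OF T]) (rule invertible_upward)
  have onset_invertible: "invertible (P t)" if "onset P < t" for t
    by (rule invertible_after_onset(2)[of T P, OF T _ that]) (rule invertible_upward)
  note onset = onset_nonneg onset_invertible

  have regression: "dxf t = \<phi>f t + \<Phi>f t *v \<theta>" if "0 \<le> t" for t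
    using filter_of_derivative[OF filt_x filtered_add[OF filt_\<phi> filtered_bounded_linear[OF filt_\<Phi>
          bounded_linear_matrix_vector_mult_left]] x k that] .
  have Q_eq: "Q t = P t *v \<theta>" if "0 \<le> t" for t
  proof -
    have "ode_solution (\<lambda>t. Q t - P t *v \<theta>) (\<lambda>t. - l_e *\<^sub>R (Q t - P t *v \<theta>))"
      by (rule ode_solution_cong[OF ode_solution_diff[OF Q(2) P_apply_ode]])
         (simp add: regression algebra_simps)
    from linear_decay_from_zero[OF this _ that] show ?thesis
      by (simp add: P Q)
  qed
  have W_eq: "W t = P t *v (\<theta>h t - \<theta>)" if "0 \<le> t" for t
    by (simp add: W Q_eq that matrix_vector_mult_diff_distrib)

  define V where "V t = 1 / 2 * ((\<theta>h t - \<theta>) \<bullet> (matrix_inv \<Gamma> *v (\<theta>h t - \<theta>)))" for t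
  have V_pos: "0 < V t \<longleftrightarrow> \<theta>h t \<noteq> \<theta>" and V_nonneg: "0 \<le> V t" for t
    using pos_def_inverse_form[OF \<Gamma>, of "\<theta>h t - \<theta>"] by (cases "\<theta>h t = \<theta>"; simp add: V_def)+
  have V_der: "(V has_real_derivative - c1 * V t powr \<gamma>1 - c2 * V t powr \<gamma>2) (at t)"
    if t: "onset P < t" and "0 < V t" for t
  proof -
    have "0 < t" and inv: "invertible (P t)" and e: "\<theta>h t - \<theta> \<noteq> 0"
      using onset t \<open>0 < V t\<close> V_pos by auto
    have form: "0 < (\<theta>h t - \<theta>) \<bullet> (P t *v (\<theta>h t - \<theta>))"
      by (rule invertible_imp_form_pos[OF \<open>0 < t\<close> inv e])
    then have "W t \<noteq> 0"
      using W_eq[of t] \<open>0 < t\<close> by auto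
    with law[OF \<open>0 < t\<close> inv]
    have "(\<theta>h has_vector_derivative
        adaptation_law \<Gamma> c1 c2 \<gamma>1 \<gamma>2 (P t) (P t *v (\<theta>h t - \<theta>))) (at t)"
      using W_eq[of t] \<open>0 < t\<close> by simp
    from lyapunov_derivative[OF inv \<Gamma> form this] show ?thesis
      unfolding V_def .
  qed
  have V_cont: "continuous_on {onset P..} V"
    unfolding V_def
    by (intro continuous_intros continuous_on_subset[OF \<theta>h_cont]
        bounded_linear.continuous_on[OF matrix_vector_mul_bounded_linear])
       (use onset in auto)
  obtain T\<^sub>\<theta> where T\<^sub>\<theta>: "0 \<le> T\<^sub>\<theta>" "T\<^sub>\<theta> \<le> 1 / (c1 * (1 - \<gamma>1)) + 1 / (c2 * (\<gamma>2 - 1))"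
    and before: "\<And>t. \<lbrakk>onset P \<le> t; t < onset P + T\<^sub>\<theta>\<rbrakk> \<Longrightarrow> 0 < V t"
    and after: "\<And>t. onset P + T\<^sub>\<theta> \<le> t \<Longrightarrow> V t = 0"
    using fixed_time_extinction[OF c \<gamma> V_cont V_nonneg V_der] by blast
  have settled: "\<theta>h t = \<theta>" if "onset P + T\<^sub>\<theta> \<le> t" for t
    using after[OF that] V_pos[of t] by simp
  have lim: "(\<theta>h \<longlongrightarrow> \<theta>) (at (onset P + T\<^sub>\<theta>) within {0..})"
    using \<theta>h_cont settled[of "onset P + T\<^sub>\<theta>"] onset T\<^sub>\<theta> by (auto simp: continuous_on_def)
  moreover have "((\<lambda>t. \<theta> - \<theta>h t) \<longlongrightarrow> 0) (at (onset P + T\<^sub>\<theta>) within {0..})"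
    using tendsto_diff[OF tendsto_const lim, of \<theta>] by simp
  ultimately show ?thesis
    using onset T\<^sub>\<theta> before V_pos settled by blast
qed

end
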